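(* For every integer $n \geq 0$, $rd_0(2n+1)$ equals the total number of $H$ steps in all peakless Motzkin paths of length $n$, and $rd_0(2n+2)$ equals the total number of $H$ steps plus the total number of $U$ steps in all peakless Motzkin paths of length $n$. That is, \[rd_0(2n + 1) = \# \{H\text{'s in peakless Motzkin paths of length }n\}\] and \[rd_0(2n + 2) = \# \{H\text{'s} + U\text{'s in peakless Motzkin paths of length }n\}.\]
   Context: An integer partition is a weakly decreasing finite sequence $\mu = (\mu_1, \ldots, \mu_m)$ of positive integers (its parts); $\ell(\mu) := m$ is its length. The perimeter of a nonempty partition $\mu$ is $P(\mu) := \mu_1 + \ell(\mu) - 1$. $rd_0(n)$ is the number of partitions with perimeter $n$ into distinct parts that have an equal number of even parts and odd parts. A Motzkin path of length $n$ is a lattice path from $(0,0)$ to $(n,0)$ that only takes steps $U = (1,1)$, $H = (1,0)$ and $D = (1,-1)$ and does not travel below the $x$-axis. A peakless Motzkin path is a Motzkin path that has no $U$ step immediately followed by a $D$ step. The counts are over all pairs (path, step of the given type in that path). *)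

theory Defs
  imports Main "HOL-Library.Product_Plus"
begin

definition is_partition :: "nat list \<Rightarrow> bool" where
  "is_partition \<mu> \<longleftrightarrow> sorted_wrt (\<ge>) \<mu> \<and> (\<forall>x\<in>set \<mu>. 0 < x)"

(* Only meaningful for nonempty partitions, where the subtraction does not truncate. *)
definition perimeter :: "nat list \<Rightarrow> nat" where
  "perimeter \<mu> = hd \<mu> + length \<mu> - 1"

definition rd0_set :: "nat \<Rightarrow> nat list set" where
  "rd0_set n = {\<mu>. is_partition \<mu> \<and> \<mu> \<noteq> [] \<and> perimeter \<mu> = n \<and> distinct \<mu> \<and>
                    length (filter even \<mu>) = length (filter odd \<mu>)}"

definition rd0 :: "nat \<Rightarrow> nat" where
  "rd0 n = card (rd0_set n)"

datatype step = U | H | D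

fun step_vec :: "step \<Rightarrow> int \<times> int" where
  "step_vec U = (1, 1)"
| "step_vec H = (1, 0)"
| "step_vec D = (1, -1)"

(* A lattice path starting at the origin is encoded by its list of steps;
   path_point p k is the point reached after the first k steps. *)
definition path_point :: "step list \<Rightarrow> nat \<Rightarrow> int \<times> int" where
  "path_point p k = sum_list (map step_vec (take k p))"

definition motzkin_path :: "nat \<Rightarrow> step list \<Rightarrow> bool" where
  "motzkin_path n p \<longleftrightarrow> path_point p (length p) = (int n, 0) \<and>
                        (\<forall>k\<le>length p. 0 \<le> snd (path_point p k))"

definition peakless :: "step list \<Rightarrow> bool" where
  "peakless p \<longleftrightarrow> (\<forall>i. Suc i < length p \<longrightarrow> \<not> (p ! i = U \<and> p ! Suc i = D))"

definition peakless_motzkin_paths :: "nat \<Rightarrow> step list set" where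
  "peakless_motzkin_paths n = {p. motzkin_path n p \<and> peakless p}"

(* A step of a path is identified by its position in the list of steps. *)
definition marked_steps :: "step \<Rightarrow> nat \<Rightarrow> (step list \<times> nat) set" where
  "marked_steps s n = {(p, i). p \<in> peakless_motzkin_paths n \<and> i < length p \<and> p ! i = s}"

definition total_steps :: "step \<Rightarrow> nat \<Rightarrow> nat" where
  "total_steps s n = card (marked_steps s n)"

(* The cardinalities above are those of finite sets. *)

lemma finite_rd0_set: "finite (rd0_set n)"
proof (rule finite_subset)
  show "rd0_set n \<subseteq> {\<mu>. set \<mu> \<subseteq> {..n} \<and> length \<mu> \<le> n}"
  proof
    fix \<mu> assume a: "\<mu> \<in> rd0_set n"
    then obtain x xs where \<mu>: "\<mu> = x # xs"
      by (cases \<mu>) (auto simp: rd0_set_def)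
    from a show "\<mu> \<in> {\<mu>. set \<mu> \<subseteq> {..n} \<and> length \<mu> \<le> n}"
      by (auto simp: \<mu> rd0_set_def is_partition_def perimeter_def intro: trans_le_add1)
  qed
  show "finite {\<mu>. set \<mu> \<subseteq> {..n} \<and> length \<mu> \<le> n}"
    by (rule finite_lists_length_le) simp
qed

lemma motzkin_path_length: "motzkin_path n p \<Longrightarrow> length p = n"
proof -
  have "fst (step_vec s) = 1" for s
    by (cases s) auto
  then have "fst (sum_list (map step_vec q)) = int (length q)" for q
    by (induction q) auto
  from this[of p] show "motzkin_path n p \<Longrightarrow> length p = n"
    by (auto simp: motzkin_path_def path_point_def)
qed

lemma finite_marked_steps: "finite (marked_steps s n)"
proof (rule finite_subset)
  show "marked_steps s n \<subseteq> {p. set p \<subseteq> {U, H, D} \<and> length p = n} \<times> {..<n}"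
    using step.exhaust
    by (auto simp: marked_steps_def peakless_motzkin_paths_def dest: motzkin_path_length)
  show "finite ({p. set p \<subseteq> {U, H, D} \<and> length p = n} \<times> {..<n})"
    by (intro finite_cartesian_product finite_lists_length_eq) auto
qed

end

(* A partition with 2(j+1) parts and perimeter N has largest part M = N - 1 - 2j, and its other
   parts are chosen freely among the even and the odd numbers below M, so rd0 N is a sum over j
   of products of two binomial coefficients. On the other side, peakless paths from height h down
   to 0 with a H's and u U's have a closed ballot-type count, proved by removing the first step.
   At h = 0, multiplying it by the number a of H's, or by a + u, absorbs the ballot factor
   1 / (u + 1) into a binomial coefficient, and the result is the summand with j = u. *)

theory Submission
  imports Defs Complex_Main
begin

section \<open>Recursive description of peakless paths\<close>

text \<open>Paths from height \<open>h\<close> down to height 0; \<open>b\<close> records that the preceding step was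
  \<open>U\<close>, so that a \<open>D\<close> is forbidden as the first step.\<close>

fun peakless_from :: "bool \<Rightarrow> nat \<Rightarrow> step list \<Rightarrow> bool" where
  "peakless_from b h [] \<longleftrightarrow> h = 0"
| "peakless_from b h (U # xs) \<longleftrightarrow> peakless_from True (Suc h) xs"
| "peakless_from b h (H # xs) \<longleftrightarrow> peakless_from False h xs"
| "peakless_from b h (D # xs) \<longleftrightarrow> \<not> b \<and> 0 < h \<and> peakless_from False (h - 1) xs"

lemma peakless_Cons:
  "peakless (x # xs) \<longleftrightarrow> peakless xs \<and> \<not> (x = U \<and> xs \<noteq> [] \<and> hd xs = D)"
proof -
  have "(\<forall>i. Q i) \<longleftrightarrow> Q 0 \<and> (\<forall>i. Q (Suc i))" for Q :: "nat \<Rightarrow> bool"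
    by (metis not0_implies_Suc)
  from this[of "\<lambda>i. Suc i < length (x # xs) \<longrightarrow> \<not> ((x # xs) ! i = U \<and> (x # xs) ! Suc i = D)"]
  show ?thesis
    by (auto simp: peakless_def hd_conv_nth)
qed

text \<open>Applied to the height condition, this splits off the starting point and leaves a
  condition on the path after its first step.\<close>

lemma all_prefixes_Cons:
  "(\<forall>k\<le>length (x # xs). Q (take k (x # xs))) \<longleftrightarrow> Q [] \<and> (\<forall>k\<le>length xs. Q (x # take k xs))"
proof -
  have "(\<forall>i. R i) \<longleftrightarrow> R 0 \<and> (\<forall>i. R (Suc i))" for R :: "nat \<Rightarrow> bool"
    by (metis not0_implies_Suc)
  from this[of "\<lambda>k. k \<le> length (x # xs) \<longrightarrow> Q (take k (x # xs))"] show ?thesis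
    by simp
qed

text \<open>An arbitrary starting height \<open>h\<close> and the flag \<open>b\<close> let the
  induction remove the first step; \<open>h = 0\<close> with \<open>b = False\<close> gives the
  peakless Motzkin paths.\<close>

lemma peakless_from_iff:
  "peakless_from b h p \<longleftrightarrow>
     int h + snd (sum_list (map step_vec p)) = 0 \<and>
     (\<forall>k\<le>length p. 0 \<le> int h + snd (sum_list (map step_vec (take k p)))) \<and>
     peakless p \<and> \<not> (b \<and> p \<noteq> [] \<and> hd p = D)"
proof (induction b h p rule: peakless_from.induct)
  case (1 b h)
  then show ?case by (simp add: peakless_def)
next
  case (2 b h xs)
  show ?case
    unfolding all_prefixes_Cons[where Q = "\<lambda>q. 0 \<le> int h + snd (sum_list (map step_vec q))"]
    using 2 by (auto simp: peakless_Cons algebra_simps)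
next
  case (3 b h xs)
  show ?case
    unfolding all_prefixes_Cons[where Q = "\<lambda>q. 0 \<le> int h + snd (sum_list (map step_vec q))"]
    using 3 by (auto simp: peakless_Cons algebra_simps)
next
  case (4 b h xs)
  show ?case
  proof (cases "0 < h")
    case True
    then show ?thesis
      unfolding all_prefixes_Cons[where Q = "\<lambda>q. 0 \<le> int h + snd (sum_list (map step_vec q))"]
      using 4 by (auto simp: peakless_Cons algebra_simps of_nat_diff)
  next
    case False
    \<comment> \<open>From height 0 the prefix consisting of \<open>D\<close> alone, given by
      \<open>k = 0\<close>, already ends at height -1.\<close>
    have "\<exists>k\<le>length xs. \<not> 0 \<le> int h + snd (sum_list (map step_vec (D # take k xs)))"
      using False by (intro exI[of _ 0]) simp
    then show ?thesis
      unfolding all_prefixes_Cons[where Q = "\<lambda>q. 0 \<le> int h + snd (sum_list (map step_vec q))"]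
      using False by auto
  qed
qed

lemma fst_sum_step_vec: "fst (sum_list (map step_vec p)) = int (length p)"
proof -
  have "fst (step_vec s) = 1" for s
    by (cases s) auto
  then show ?thesis
    by (induction p) auto
qed

lemma peakless_motzkin_paths_eq:
  "peakless_motzkin_paths n = {p. peakless_from False 0 p \<and> length p = n}"
  by (auto simp: peakless_motzkin_paths_def motzkin_path_def path_point_def
      peakless_from_iff prod_eq_iff fst_sum_step_vec)

text \<open>A path from height \<open>h\<close> to 0 has \<open>h\<close> more \<open>D\<close>
  steps than \<open>U\<close> steps.\<close>

lemma length_peakless_from:
  "peakless_from b h p \<Longrightarrow> length p = count_list p H + 2 * count_list p U + h"
  by (induction b h p rule: peakless_from.induct) auto

section \<open>Counting by the numbers of \<open>H\<close> and \<open>U\<close> steps\<close>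

definition peakless_paths :: "bool \<Rightarrow> nat \<Rightarrow> nat \<Rightarrow> nat \<Rightarrow> step list set" where
  "peakless_paths b a u h =
     {p. peakless_from b h p \<and> count_list p H = a \<and> count_list p U = u}"

lemma finite_peakless_paths [simp]: "finite (peakless_paths b a u h)"
proof (rule finite_subset)
  show "peakless_paths b a u h \<subseteq> {p. set p \<subseteq> {U, H, D} \<and> length p = a + 2 * u + h}"
    using step.exhaust by (auto simp: peakless_paths_def dest: length_peakless_from)
  show "finite {p. set p \<subseteq> {U, H, D} \<and> length p = a + 2 * u + h}"
    by (intro finite_lists_length_eq) auto
qed

lemma peakless_paths_decomp:
  "peakless_paths b a u h =
     (if a = 0 \<and> u = 0 \<and> h = 0 then {[]} else {}) \<union>
     ((if u = 0 then {} else (#) U ` peakless_paths True a (u - 1) (Suc h)) \<union>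
     ((if a = 0 then {} else (#) H ` peakless_paths False (a - 1) u h) \<union>
      (if b \<or> h = 0 then {} else (#) D ` peakless_paths False a u (h - 1))))"
  (is "?L = ?R")
proof (rule set_eqI)
  fix p
  show "p \<in> ?L \<longleftrightarrow> p \<in> ?R"
  proof (cases p)
    case Nil
    then show ?thesis by (auto simp: peakless_paths_def)
  next
    case (Cons s q)
    then show ?thesis by (cases s) (auto simp: peakless_paths_def)
  qed
qed

text \<open>The classes given by the first step are disjoint and prepending a step is injective, so
  the cardinalities add.\<close>

lemma card_peakless_paths_rec:
  "card (peakless_paths b a u h) =
     (if a = 0 \<and> u = 0 \<and> h = 0 then 1 else 0) +
     (if u = 0 then 0 else card (peakless_paths True a (u - 1) (Suc h))) +
     (if a = 0 then 0 else card (peakless_paths False (a - 1) u h)) +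
     (if b \<or> h = 0 then 0 else card (peakless_paths False a u (h - 1)))"
proof -
  define N where "N = (if a = 0 \<and> u = 0 \<and> h = 0 then {[] :: step list} else {})"
  define A where "A = (if u = 0 then {} else (#) U ` peakless_paths True a (u - 1) (Suc h))"
  define B where "B = (if a = 0 then {} else (#) H ` peakless_paths False (a - 1) u h)"
  define C where "C = (if b \<or> h = 0 then {} else (#) D ` peakless_paths False a u (h - 1))"
  have fin: "finite N" "finite A" "finite B" "finite C"
    by (simp_all add: N_def A_def B_def C_def)
  have "N \<inter> (A \<union> (B \<union> C)) = {}" "A \<inter> (B \<union> C) = {}" "B \<inter> C = {}"
    by (auto simp: N_def A_def B_def C_def)
  with fin have "card (N \<union> (A \<union> (B \<union> C))) = card N + card A + card B + card C"
    by (simp add: card_Un_disjoint)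
  moreover have "peakless_paths b a u h = N \<union> (A \<union> (B \<union> C))"
    unfolding N_def A_def B_def C_def by (rule peakless_paths_decomp)
  ultimately show ?thesis
    by (simp add: N_def A_def B_def C_def card_image)
qed

section \<open>The closed ballot-type count\<close>

text \<open>The cycle lemma predicts this count: reading a path backwards, each \<open>H\<close> absorbs the run of
  descents after it. For \<open>a = u = 0\<close> the truncated \<open>a + u - 1\<close> correctly gives \<open>0 choose 0 = 1\<close>.\<close>

definition ballot :: "nat \<Rightarrow> nat \<Rightarrow> nat \<Rightarrow> real" where
  "ballot a u h =
     real (h + 1) / real (h + u + 1) * real ((h + u + a) choose a) * real ((a + u - 1) choose u)"

text \<open>The count of the paths that do not begin with \<open>D\<close>.\<close>

definition ballot_diff :: "nat \<Rightarrow> nat \<Rightarrow> nat \<Rightarrow> real" where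
  "ballot_diff a u h = ballot a u h - (if h = 0 then 0 else ballot a u (h - 1))"

lemma ballot_0_right: "ballot a 0 h = real ((h + a) choose a)"
  by (simp add: ballot_def)

lemma ballot_0_left: "ballot 0 u h = of_bool (u = 0)"
  by (cases u) (simp_all add: ballot_def)

text \<open>With at least one \<open>H\<close> the subtraction in \<open>a + u - 1\<close> does not
  truncate, and the factor \<open>h + u + 1\<close> merges into a factorial.\<close>

lemma ballot_Suc:
  "ballot (Suc a) u h = real (h + 1) * fact (Suc (h + u + a)) * fact (a + u) /
     (fact (Suc (h + u)) * fact (Suc a) * fact a * fact u)"
proof -
  have "real ((h + u + Suc a) choose Suc a) =
      fact (Suc (h + u + a)) / (fact (Suc a) * fact (h + u))"
    by (subst binomial_fact) (simp_all del: fact_Suc)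
  moreover have "real ((a + u) choose u) = fact (a + u) / (fact u * fact a)"
    by (subst binomial_fact) simp_all
  moreover have "fact (Suc (h + u)) = real (h + u + 1) * fact (h + u)"
    by simp
  ultimately show ?thesis
    unfolding ballot_def by simp
qed

text \<open>This mirrors the recursion for paths that begin with \<open>U\<close> or
  \<open>H\<close>. For \<open>u = 0\<close> it is Pascal's rule; for positive \<open>a\<close> and
  \<open>u\<close> it reduces to a polynomial identity.\<close>

lemma ballot_diff_rec:
  assumes "\<not> (a = 0 \<and> u = 0 \<and> h = 0)"
  shows "ballot_diff a u h =
     (if u = 0 then 0 else ballot_diff a (u - 1) (Suc h)) +
     (if a = 0 then 0 else ballot (a - 1) u h)"
proof -
  consider "a = 0" | "a \<noteq> 0" "u = 0" | b v where "a = Suc b" "u = Suc v"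
    by (metis not0_implies_Suc)
  then show ?thesis
  proof cases
    case 1
    then show ?thesis
      using assms by (auto simp: ballot_diff_def ballot_0_left)
  next
    case 2
    then show ?thesis
      by (cases a; cases h) (auto simp: ballot_diff_def ballot_0_right)
  next
    case 3
    define x y z s t w where x: "x = real h + 1" and y: "y = real v + 1" and z: "z = real b + 1"
      and s: "s = real h + real v + real b + 2" and t: "t = real h + real v + 2"
      and w: "w = real b + real v + 1"
    note vars = x y z s t w
    \<comment> \<open>Each factorial in the five ballot numbers is one of these or differs from one
      of them by a single linear factor.\<close>
    define F G K L M :: real where F: "F = fact (Suc (h + v + b))" and G: "G = fact (b + v)"
      and K: "K = fact (Suc (h + v))" and L: "L = fact b" and M: "M = fact v"
    note facts = F G K L M
    have nz: "t \<noteq> 0" "y \<noteq> 0" "z \<noteq> 0" "K \<noteq> 0" "L \<noteq> 0" "M \<noteq> 0"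
      unfolding vars facts by (simp_all del: fact_Suc)
    have f: "fact (Suc (Suc (h + v + b))) = s * F" "fact (Suc (b + v)) = w * G"
      "fact (Suc (Suc (h + v))) = t * K" "fact (Suc b) = z * L" "fact (Suc v) = y * M"
      unfolding vars facts by (simp_all add: algebra_simps)
    note rules = f facts[symmetric]
    \<comment> \<open>All five ballot numbers of the recurrence are polynomial multiples of \<open>X\<close>.\<close>
    define X where "X = F * G / (t * K * z * L * L * y * M)"
    have auh: "ballot a u h = x * s * w * X"
    proof -
      have "ballot a u h = x * (s * F) * (w * G) / (t * K * (z * L) * L * (y * M))"
        unfolding 3 ballot_Suc by (simp add: rules x del: fact_Suc)
      then show ?thesis by (simp add: X_def nz mult_ac)
    qed
    \<comment> \<open>For \<open>h = 0\<close> the factor \<open>x - 1\<close> vanishes, so one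
      formula covers both branches.\<close>
    have auh_pred: "(if h = 0 then 0 else ballot a u (h - 1)) = (x - 1) * t * w * X"
    proof (cases h)
      case (Suc k)
      have "fact (Suc (Suc (k + v + b))) = F" "fact (Suc (Suc (k + v))) = K" "real (k + 1) = x - 1"
        by (simp_all add: Suc x F K)
      then have "ballot a u k = (x - 1) * F * (w * G) / (K * (z * L) * L * (y * M))"
        unfolding 3 ballot_Suc by (simp add: rules del: fact_Suc)
      then show ?thesis by (simp add: Suc X_def nz mult_ac)
    qed (simp add: x)
    have avh_Suc: "ballot a v (Suc h) = (x + 1) * s * y * X"
    proof -
      have "ballot a v (Suc h) = (x + 1) * (s * F) * G / (t * K * (z * L) * L * M)"
        unfolding 3 ballot_Suc by (simp add: rules x del: fact_Suc)
      then show ?thesis by (simp add: X_def nz mult_ac)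
    qed
    have avh: "ballot a v h = x * t * y * X"
    proof -
      have "ballot a v h = x * F * G / (K * (z * L) * L * M)"
        unfolding 3 ballot_Suc by (simp add: rules x del: fact_Suc)
      then show ?thesis by (simp add: X_def nz mult_ac)
    qed
    have buh: "ballot b u h = x * z * (z - 1) * X"
    \<comment> \<open>\<open>ballot_Suc\<close> does not apply to \<open>b = 0\<close>; there the
      count is 0 because \<open>u\<close> is positive, which the factor \<open>z - 1\<close>
      reproduces.\<close>
    proof (cases b)
      case 0
      then show ?thesis by (simp add: 3 ballot_0_left z)
    next
      case (Suc c)
      have L': "L = (z - 1) * fact c" and nz': "z - 1 \<noteq> 0"
        by (simp_all add: Suc z L)
      have "fact (Suc (Suc (h + v + c))) = F" "fact (Suc (c + v)) = G" "fact (Suc c) = L"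
        by (simp_all add: Suc F G L add_ac)
      then have "ballot b u h = x * F * G / (t * K * L * fact c * (y * M))"
        unfolding 3 Suc ballot_Suc by (simp add: f(3,5) facts(3,5)[symmetric] x del: fact_Suc)
      then show ?thesis using nz' by (simp add: X_def L' nz mult_ac)
    qed
    \<comment> \<open>The recurrence without the common factor \<open>X\<close>; both sides equal
      \<open>(x * z + y) * w\<close>.\<close>
    have "(x * s - (x - 1) * t) * w = ((x + 1) * s - x * t) * y + x * z * (z - 1)"
      unfolding vars by (simp add: algebra_simps)
    from arg_cong[OF this, of "\<lambda>c. c * X"]
    have "ballot_diff a u h = ballot_diff a v (Suc h) + ballot b u h"
      unfolding ballot_diff_def auh auh_pred buh by (simp add: avh avh_Suc algebra_simps)
    then show ?thesis by (simp add: 3)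
  qed
qed

text \<open>The measure \<open>a + 2 * u + h\<close> is the length of the paths, so each first-step
  reduction decreases it by one.\<close>

lemma card_peakless_paths:
  "real (card (peakless_paths b a u h)) = (if b then ballot_diff a u h else ballot a u h)"
proof (induction "a + 2 * u + h" arbitrary: b a u h rule: less_induct)
  case less
  have U: "real (card (peakless_paths True a (u - 1) (Suc h))) = ballot_diff a (u - 1) (Suc h)"
    if "u \<noteq> 0"
    using less[of a "u - 1" "Suc h" True] that by simp
  have H: "real (card (peakless_paths False (a - 1) u h)) = ballot (a - 1) u h" if "a \<noteq> 0"
    using less[of "a - 1" u h False] that by simp
  have D: "real (card (peakless_paths False a u (h - 1))) = ballot a u (h - 1)" if "h \<noteq> 0"
    using less[of a u "h - 1" False] that by simp
  show ?case
  proof (cases "a = 0 \<and> u = 0 \<and> h = 0")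
    case True
    then show ?thesis
      by (subst card_peakless_paths_rec) (simp add: ballot_diff_def ballot_0_right)
  next
    case False
    \<comment> \<open>The last summand counts the paths that begin with \<open>D\<close>; splitting
      it off reduces both values of \<open>b\<close> to \<open>ballot_diff_rec\<close>.\<close>
    have eq: "ballot a u h = ballot_diff a u h + (if h = 0 then 0 else ballot a u (h - 1))"
      by (simp add: ballot_diff_def)
    show ?thesis
      unfolding eq ballot_diff_rec[OF False]
      using False U H D by (subst card_peakless_paths_rec) auto
  qed
qed

section \<open>Absorption identities at height 0\<close>

lemma card_peakless_paths_ground:
  "(u + 1) * card (peakless_paths False a u 0) = ((a + u) choose u) * ((a + u - 1) choose u)"
proof -
  have "real (u + 1) * ballot a u 0 = real ((a + u) choose u) * real ((a + u - 1) choose u)"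
    using binomial_symmetric[of u "a + u"] by (simp add: ballot_def add.commute)
  then have "real ((u + 1) * card (peakless_paths False a u 0)) =
      real (((a + u) choose u) * ((a + u - 1) choose u))"
    unfolding of_nat_mult card_peakless_paths by simp
  then show ?thesis
    by (simp only: of_nat_eq_iff)
qed

text \<open>Here the first binomial of the ground count absorbs \<open>a\<close> and turns
  \<open>u\<close> into \<open>u + 1\<close>.\<close>

lemma card_peakless_paths_times_H:
  "a * card (peakless_paths False a u 0) = ((a + u - 1) choose u) * ((a + u) choose (u + 1))"
proof -
  have "(u + 1) * ((a + u) choose (u + 1)) = a * ((a + u) choose u)"
    using binomial_absorb_comp[of "a + u" u] binomial_absorption[of u "a + u"] by simp
  then have "(u + 1) * (a * card (peakless_paths False a u 0)) =
      (u + 1) * (((a + u - 1) choose u) * ((a + u) choose (u + 1)))"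
    using card_peakless_paths_ground[of u a] by (metis mult.left_commute mult.commute)
  then show ?thesis
    by (simp only: mult_cancel1) simp
qed

text \<open>Here the second binomial of the ground count absorbs \<open>a + u\<close>, which raises
  both of its entries by one.\<close>

lemma card_peakless_paths_times_HU:
  "(a + u) * card (peakless_paths False a u 0) = ((a + u) choose u) * ((a + u) choose (u + 1))"
proof -
  have "(u + 1) * ((a + u) choose (u + 1)) = (a + u) * ((a + u - 1) choose u)"
    using binomial_absorption[of u "a + u"] by simp
  then have "(u + 1) * ((a + u) * card (peakless_paths False a u 0)) =
      (u + 1) * (((a + u) choose u) * ((a + u) choose (u + 1)))"
    using card_peakless_paths_ground[of u a] by (metis mult.left_commute mult.commute)
  then show ?thesis
    by (simp only: mult_cancel1) simp
qed

section \<open>Step totals as sums over the number of \<open>U\<close> steps\<close>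

lemma finite_peakless_motzkin_paths: "finite (peakless_motzkin_paths n)"
proof (rule finite_subset)
  show "peakless_motzkin_paths n \<subseteq> {p. set p \<subseteq> {U, H, D} \<and> length p = n}"
    using step.exhaust by (auto simp: peakless_motzkin_paths_eq)
  show "finite {p. set p \<subseteq> {U, H, D} \<and> length p = n}"
    by (intro finite_lists_length_eq) auto
qed

lemma total_steps_eq_sum: "total_steps s n = (\<Sum>p\<in>peakless_motzkin_paths n. count_list p s)"
proof -
  have "marked_steps s n = (SIGMA p:peakless_motzkin_paths n. {i. i < length p \<and> p ! i = s})"
    by (auto simp: marked_steps_def)
  then show ?thesis
    by (simp add: total_steps_def finite_peakless_motzkin_paths count_list_eq_length_filter
        length_filter_conv_card eq_commute)
qed

text \<open>Length \<open>n\<close> and \<open>u\<close> steps \<open>U\<close> force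
  \<open>n - 2 * u\<close> steps \<open>H\<close>, so grouping by \<open>u\<close> makes the weight
  \<open>f\<close> constant on each group.\<close>

lemma sum_peakless_motzkin_paths:
  "(\<Sum>p\<in>peakless_motzkin_paths n. f (count_list p H) (count_list p U)) =
   (\<Sum>u\<in>{u. 2 * u \<le> n}. f (n - 2 * u) u * card (peakless_paths False (n - 2 * u) u 0))"
proof -
  have fin: "finite {u. 2 * u \<le> n}"
    by (rule finite_subset[of _ "{..n}"]) auto
  have sub: "(\<lambda>p. count_list p U) ` peakless_motzkin_paths n \<subseteq> {u. 2 * u \<le> n}"
    by (auto simp: peakless_motzkin_paths_eq dest: length_peakless_from)
  have "{p \<in> peakless_motzkin_paths n. count_list p U = u} = peakless_paths False (n - 2 * u) u 0"
    if "2 * u \<le> n" for u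
    using that by (auto simp: peakless_motzkin_paths_eq peakless_paths_def
        dest: length_peakless_from)
  then show ?thesis
    unfolding sum.group[OF finite_peakless_motzkin_paths fin sub, symmetric]
    by (intro sum.cong) (auto simp: peakless_paths_def)
qed

section \<open>Sets with prescribed numbers of even and odd elements\<close>

text \<open>The candidates for the set of parts below a largest part \<open>M\<close>.\<close>

definition parity_subsets :: "nat \<Rightarrow> nat \<Rightarrow> nat \<Rightarrow> nat set set" where
  "parity_subsets M e d =
     {B. B \<subseteq> {1..<M} \<and> card {x \<in> B. even x} = e \<and> card {x \<in> B. odd x} = d}"

text \<open>The even and the odd elements are chosen independently.\<close>

lemma card_parity_subsets:
  "card (parity_subsets M e d) =
     (card {x \<in> {1..<M}. even x} choose e) * (card {x \<in> {1..<M}. odd x} choose d)"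
proof -
  let ?E = "{x \<in> {1..<M}. even x}" and ?O = "{x \<in> {1..<M}. odd x}"
  have "bij_betw (\<lambda>B. ({x \<in> B. even x}, {x \<in> B. odd x})) (parity_subsets M e d)
          ({A. A \<subseteq> ?E \<and> card A = e} \<times> {A. A \<subseteq> ?O \<and> card A = d})"
  proof (rule bij_betw_byWitness[where f' = "\<lambda>(A, B). A \<union> B"])
    have eq: "{x \<in> A \<union> B. even x} = A" "{x \<in> A \<union> B. odd x} = B"
      if "A \<subseteq> ?E" "B \<subseteq> ?O" for A B
      using that by auto
    show "\<forall>p\<in>{A. A \<subseteq> ?E \<and> card A = e} \<times> {A. A \<subseteq> ?O \<and> card A = d}.
      (\<lambda>B. ({x \<in> B. even x}, {x \<in> B. odd x})) ((\<lambda>(A, B). A \<union> B) p) = p"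
      by (clarsimp simp only: mem_Sigma_iff mem_Collect_eq case_prod_conv eq simp_thms)
    show "(\<lambda>(A, B). A \<union> B) ` ({A. A \<subseteq> ?E \<and> card A = e} \<times> {A. A \<subseteq> ?O \<and> card A = d})
        \<subseteq> parity_subsets M e d"
    proof clarify
      fix A B
      assume "A \<subseteq> ?E" "B \<subseteq> ?O"
      moreover from this have "A \<union> B \<subseteq> {1..<M}" by auto
      ultimately show "A \<union> B \<in> parity_subsets M (card A) (card B)"
        unfolding parity_subsets_def mem_Collect_eq by (simp only: eq simp_thms)
    qed
  qed (auto simp: parity_subsets_def)
  then show ?thesis
    by (simp add: bij_betw_same_card card_cartesian_product n_subsets)
qed

lemma card_filter_insert:
  assumes "finite B" "M \<notin> B"
  shows "card {x \<in> insert M B. Q x} = card {x \<in> B. Q x} + of_bool (Q M)"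
proof -
  have "{x \<in> insert M B. Q x} = (if Q M then insert M {x \<in> B. Q x} else {x \<in> B. Q x})"
    by auto
  then show ?thesis
    using assms by simp
qed

text \<open>The guard \<open>0 < M\<close> is there because the interval starts at 1: passing from
  \<open>M = 0\<close> to 1 adds no element.\<close>

lemma card_filter_below_Suc:
  "card {x \<in> {1..<Suc M}. Q x} = card {x \<in> {1..<M}. Q x} + of_bool (0 < M \<and> Q M)"
proof (cases "0 < M")
  case True
  then have "{1..<Suc M} = insert M {1..<M}" by auto
  then show ?thesis
    using True card_filter_insert[of "{1..<M}" M Q] by (simp only:) simp
qed simp

lemma card_even_below: "card {x \<in> {1..<M}. even x} = (M - 1) div 2"
proof (induction M)
  case (Suc M)
  have "(M - 1) div 2 + of_bool (0 < M \<and> even M) = M div 2"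
    by (cases "0 < M \<and> even M"; simp; presburger)
  with Suc show ?case
    by (simp only: card_filter_below_Suc diff_Suc_1)
qed simp

lemma card_odd_below: "card {x \<in> {1..<M}. odd x} = M div 2"
proof (induction M)
  case (Suc M)
  have "M div 2 + of_bool (0 < M \<and> odd M) = Suc M div 2"
    by (cases "odd M") (auto intro: odd_pos)
  with Suc show ?case
    by (simp only: card_filter_below_Suc)
qed simp

section \<open>Partitions as a largest part and a set of smaller parts\<close>

lemma length_filter_distinct: "distinct xs \<Longrightarrow> length (filter Q xs) = card {x \<in> set xs. Q x}"
  by (metis distinct_card distinct_filter set_filter)

lemma mem_rd0_set_Cons:
  "M # xs \<in> rd0_set n \<longleftrightarrow>
     sorted_wrt (>) xs \<and> set xs \<subseteq> {1..<M} \<and> M + length xs = n \<and>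
     card {x \<in> set xs. even x} + of_bool (even M) = card {x \<in> set xs. odd x} + of_bool (odd M)"
  (is "?L \<longleftrightarrow> ?S \<and> ?A \<and> ?B \<and> ?C")
proof -
  have S: "sorted_wrt (\<ge>) ys \<and> distinct ys \<longleftrightarrow> sorted_wrt (>) ys" for ys :: "nat list"
    by (induction ys) (auto simp: order.order_iff_strict)
  have "?L \<longleftrightarrow> sorted_wrt (>) (M # xs) \<and> (\<forall>x\<in>set (M # xs). 0 < x) \<and> ?B \<and>
     length (filter even (M # xs)) = length (filter odd (M # xs))"
    using S[of "M # xs"] by (auto simp: rd0_set_def is_partition_def perimeter_def)
  also have "\<dots> \<longleftrightarrow> ?S \<and> ?A \<and> ?B \<and> length (filter even (M # xs)) = length (filter odd (M # xs))"
    \<comment> \<open>For nonempty \<open>xs\<close> a positive part below \<open>M\<close> gives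
      \<open>0 < M\<close>; for empty \<open>xs\<close> both sides fail, as a single part cannot
      balance the parities.\<close>
    by (cases xs) auto
  also have "\<dots> \<longleftrightarrow> ?S \<and> ?A \<and> ?B \<and> ?C"
    using S[of xs] length_filter_distinct[of xs] by (auto simp: add.commute)
  finally show ?thesis .
qed

text \<open>There are \<open>j + 1\<close> parts of each parity. Besides \<open>M\<close> there
  remain \<open>j\<close> parts of its parity and \<open>j + 1\<close> of the other, and the
  perimeter \<open>M + 2 * j + 1 = n\<close> determines \<open>M\<close>.\<close>

lemma rd0_set_Cons_iff_parity_subsets:
  assumes "finite B"
  shows "M # rev (sorted_list_of_set B) \<in> rd0_set n \<longleftrightarrow>
    (\<exists>j. 2 * j + 2 \<le> n \<and> M = n - 1 - 2 * j \<and>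
      B \<in> parity_subsets M (j + of_bool (odd M)) (j + of_bool (even M)))"
proof -
  let ?e = "card {x \<in> B. even x}" and ?d = "card {x \<in> B. odd x}"
  have "{x \<in> B. even x} \<union> {x \<in> B. odd x} = B" "{x \<in> B. even x} \<inter> {x \<in> B. odd x} = {}"
    by auto
  then have card: "card B = ?e + ?d"
    using card_Un_disjoint[of "{x \<in> B. even x}" "{x \<in> B. odd x}"] assms by simp
  have "M # rev (sorted_list_of_set B) \<in> rd0_set n \<longleftrightarrow>
      B \<subseteq> {1..<M} \<and> M + (?e + ?d) = n \<and> ?e + of_bool (even M) = ?d + of_bool (odd M)"
    using assms by (simp add: mem_rd0_set_Cons sorted_wrt_rev card)
  also have "\<dots> \<longleftrightarrow> (\<exists>j. 2 * j + 2 \<le> n \<and> M = n - 1 - 2 * j \<and>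
      B \<subseteq> {1..<M} \<and> ?e = j + of_bool (odd M) \<and> ?d = j + of_bool (even M))"
    (is "?A \<longleftrightarrow> (\<exists>j. ?B j)")
  proof
    assume ?A
    \<comment> \<open>If \<open>M = 0\<close>, then \<open>B\<close> is empty and the parities do
      not balance. Positivity of \<open>M\<close> yields \<open>2 * j + 2 \<le> n\<close>.\<close>
    moreover have "0 < M"
    proof (rule ccontr)
      assume "\<not> 0 < M"
      with \<open>?A\<close> show False by auto
    qed
    \<comment> \<open>The witness is the number of elements of \<open>B\<close> with the parity of
      \<open>M\<close>.\<close>
    ultimately have "?B (if even M then ?e else ?d)"
      by auto
    then show "\<exists>j. ?B j" ..
  qed (auto split: if_splits)
  finally show ?thesis
    by (simp add: parity_subsets_def)
qed

lemma rev_sorted_list_of_set_eq: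
  fixes xs :: "nat list"
  assumes "sorted_wrt (>) xs"
  shows "rev (sorted_list_of_set (set xs)) = xs"
proof -
  have "sorted_wrt (<) (rev xs)"
    using assms by (simp add: sorted_wrt_rev)
  then have "sorted_list_of_set (set (rev xs)) = rev xs"
    by (intro sorted_list_of_set.idem_if_sorted_distinct) (auto simp: strict_sorted_iff)
  then show ?thesis by simp
qed

text \<open>All values \<open>M = n - 1 - 2 * j\<close> share the parity of \<open>n - 1\<close>, so
  the numbers of even and odd smaller parts have the same form in every summand.\<close>

lemma rd0_eq_sum:
  "rd0 n = (\<Sum>j\<in>{j. 2 * j + 2 \<le> n}. card (parity_subsets (n - 1 - 2 * j)
     (j + of_bool (odd (n - 1))) (j + of_bool (even (n - 1)))))"
proof -
  let ?J = "{j. 2 * j + 2 \<le> n}"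
  let ?S = "\<lambda>j. parity_subsets (n - 1 - 2 * j) (j + of_bool (odd (n - 1))) (j + of_bool (even (n - 1)))"
  let ?f = "\<lambda>(j, B). (n - 1 - 2 * j) # rev (sorted_list_of_set B)"
  have par: "even (n - 1 - 2 * j) \<longleftrightarrow> even (n - 1)" if "2 * j + 2 \<le> n" for j
    using that by (simp add: even_diff_nat)
  have fin: "finite B" if "B \<in> ?S j" for j B
    using that by (auto simp: parity_subsets_def intro: finite_subset)
  have finJ: "finite ?J"
    by (rule finite_subset[of _ "{..n}"]) auto
  have finS: "finite (?S j)" for j
    by (rule finite_subset[of _ "Pow {1..<n - 1 - 2 * j}"]) (auto simp: parity_subsets_def)
  have "bij_betw ?f (Sigma ?J ?S) (rd0_set n)"
  proof (rule bij_betw_imageI)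
    show "inj_on ?f (Sigma ?J ?S)"
    proof (rule inj_onI)
      fix p q
      assume pq: "p \<in> Sigma ?J ?S" "q \<in> Sigma ?J ?S" "?f p = ?f q"
      obtain j B k C where jk: "p = (j, B)" "q = (k, C)"
        by (cases p, cases q)
      from pq have S: "B \<in> ?S j" "C \<in> ?S k" and le: "2 * j + 2 \<le> n" "2 * k + 2 \<le> n"
        and eq: "n - 1 - 2 * j = n - 1 - 2 * k" "sorted_list_of_set B = sorted_list_of_set C"
        by (simp_all only: jk mem_Sigma_iff mem_Collect_eq case_prod_conv list.inject rev_is_rev_conv)
      have "j = k"
        using le eq(1) by linarith
      moreover have "B = C"
        using sorted_list_of_set_inject[OF eq(2) fin[OF S(1)] fin[OF S(2)]] .
      ultimately show "p = q" by (simp add: jk)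
    qed
    show "?f ` Sigma ?J ?S = rd0_set n"
    proof (intro equalityI subsetI)
      fix \<mu> assume "\<mu> \<in> ?f ` Sigma ?J ?S"
      then obtain j B where jB: "2 * j + 2 \<le> n" "B \<in> ?S j"
        and \<mu>: "\<mu> = (n - 1 - 2 * j) # rev (sorted_list_of_set B)"
        by auto
      show "\<mu> \<in> rd0_set n"
        unfolding \<mu> rd0_set_Cons_iff_parity_subsets[OF fin[OF jB(2)]]
        using jB par[OF jB(1)] by (intro exI[of _ j]) (simp only: simp_thms)
    next
      fix \<mu> assume \<mu>: "\<mu> \<in> rd0_set n"
      then obtain M xs where Mxs: "\<mu> = M # xs"
        by (cases \<mu>) (auto simp: rd0_set_def)
      with \<mu> have xs: "rev (sorted_list_of_set (set xs)) = xs"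
        by (simp only: mem_rd0_set_Cons rev_sorted_list_of_set_eq)
      have "M # rev (sorted_list_of_set (set xs)) \<in> rd0_set n"
        using \<mu> by (simp only: xs Mxs)
      then obtain j where j: "2 * j + 2 \<le> n" and M: "M = n - 1 - 2 * j"
        and S: "set xs \<in> parity_subsets M (j + of_bool (odd M)) (j + of_bool (even M))"
        unfolding rd0_set_Cons_iff_parity_subsets[OF finite_set] by blast
      have "(j, set xs) \<in> Sigma ?J ?S"
        using j S par[OF j] by (simp only: M mem_Sigma_iff mem_Collect_eq simp_thms)
      moreover have "\<mu> = ?f (j, set xs)"
        by (simp only: xs Mxs M case_prod_conv)
      ultimately show "\<mu> \<in> ?f ` Sigma ?J ?S"
        by (rule rev_image_eqI)
    qed
  qed
  then have "rd0 n = card (Sigma ?J ?S)"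
    by (simp add: rd0_def bij_betw_same_card)
  also have "\<dots> = (\<Sum>j\<in>?J. card (?S j))"
    by (intro card_SigmaI finJ ballI finS)
  finally show ?thesis .
qed

section \<open>Evaluation at odd and even perimeters\<close>

text \<open>The largest part \<open>2 * (n - j)\<close> is even, with \<open>n - j - 1\<close> even
  and \<open>n - j\<close> odd positive numbers below it.\<close>

lemma rd0_odd:
  "rd0 (2 * n + 1) = (\<Sum>j\<in>{j. 2 * j \<le> n}. ((n - j - 1) choose j) * ((n - j) choose (j + 1)))"
proof -
  have "rd0 (2 * n + 1) = (\<Sum>j<n. ((n - j - 1) choose j) * ((n - j) choose (j + 1)))"
    unfolding rd0_eq_sum
  proof (rule sum.cong)
    fix j assume "j \<in> {..<n}"
    then have *: "2 * n - 2 * j = 2 * (n - j)" "(2 * (n - j) - Suc 0) div 2 = n - Suc j"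
      by auto
    show "card (parity_subsets (2 * n + 1 - 1 - 2 * j) (j + of_bool (odd (2 * n + 1 - 1)))
        (j + of_bool (even (2 * n + 1 - 1)))) = ((n - j - 1) choose j) * ((n - j) choose (j + 1))"
      unfolding card_parity_subsets card_even_below card_odd_below by (simp add: *)
  qed auto
  also have "\<dots> = (\<Sum>j\<in>{j. 2 * j \<le> n}. ((n - j - 1) choose j) * ((n - j) choose (j + 1)))"
    \<comment> \<open>Terms with \<open>2 * j > n\<close> vanish since \<open>n - j - 1 < j\<close>.
      The extra index \<open>j = 0\<close> at \<open>n = 0\<close> contributes
      \<open>0 choose 1 = 0\<close>.\<close>
    by (rule sum.mono_neutral_cong)
       (auto intro: finite_subset[of _ "{..n}"] simp: binomial_eq_0 not_le not_less)
  finally show ?thesis .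
qed

text \<open>The largest part \<open>2 * (n - j) + 1\<close> is odd, with \<open>n - j\<close>
  positive numbers of each parity below it.\<close>

lemma rd0_even:
  "rd0 (2 * n + 2) = (\<Sum>j\<in>{j. 2 * j \<le> n}. ((n - j) choose j) * ((n - j) choose (j + 1)))"
proof -
  have "rd0 (2 * n + 2) = (\<Sum>j\<le>n. ((n - j) choose j) * ((n - j) choose (j + 1)))"
    unfolding rd0_eq_sum
  proof (rule sum.cong)
    fix j assume "j \<in> {..n}"
    then have *: "2 * n + 1 - 2 * j = Suc (2 * (n - j))"
      by auto
    show "card (parity_subsets (2 * n + 2 - 1 - 2 * j) (j + of_bool (odd (2 * n + 2 - 1)))
        (j + of_bool (even (2 * n + 2 - 1)))) = ((n - j) choose j) * ((n - j) choose (j + 1))"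
      unfolding card_parity_subsets card_even_below card_odd_below using * by simp
  qed auto
  also have "\<dots> = (\<Sum>j\<in>{j. 2 * j \<le> n}. ((n - j) choose j) * ((n - j) choose (j + 1)))"
    by (rule sum.mono_neutral_cong)
       (auto intro: finite_subset[of _ "{..n}"] simp: binomial_eq_0 not_le)
  finally show ?thesis .
qed

theorem theorem4p6:
  fixes n :: nat
  shows "rd0 (2 * n + 1) = total_steps H n \<and>
         rd0 (2 * n + 2) = total_steps H n + total_steps U n"
proof
  \<comment> \<open>With \<open>a = n - 2 * u\<close> this is \<open>a + u = n - u\<close>, so the
    two sums agree term by term for \<open>j = u\<close>.\<close>
  have *: "n - 2 * u + u = n - u" if "2 * u \<le> n" for u
    using that by simp
  have "total_steps H n = (\<Sum>u\<in>{u. 2 * u \<le> n}.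
      (n - 2 * u) * card (peakless_paths False (n - 2 * u) u 0))"
    unfolding total_steps_eq_sum by (rule sum_peakless_motzkin_paths)
  then show "rd0 (2 * n + 1) = total_steps H n"
    unfolding rd0_odd by (simp add: card_peakless_paths_times_H * cong: sum.cong_simp)
  have "total_steps H n + total_steps U n = (\<Sum>u\<in>{u. 2 * u \<le> n}.
      (n - 2 * u + u) * card (peakless_paths False (n - 2 * u) u 0))"
    unfolding total_steps_eq_sum sum.distrib[symmetric] by (rule sum_peakless_motzkin_paths)
  then show "rd0 (2 * n + 2) = total_steps H n + total_steps U n"
    unfolding rd0_even card_peakless_paths_times_HU by (simp add: * cong: sum.cong_simp)
qed

end
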